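(* The mesh patterns $$m_1=(12,\{(0,0),(0,2),(1,1),(1,2),(2,1)\})\quad\text{and}\quad m_2=(12,\{(0,0),(0,1),(0,2),(1,1),(1,2),(2,1)\})$$ are coincident under $321$, i.e. $\mathrm{Av}(\{321,m_1\})=\mathrm{Av}(\{321,m_2\})$.
   Context: Write $[n]=\{1,\dots,n\}$. A permutation of length $n$ is a bijection of $[n]$, written in one-line notation; $G(\pi)=\{(i,\pi(i)) : i\in[n]\}$ is its plot. A mesh pattern of length $k$ is a pair $p=(\tau,R)$ with $\tau$ a permutation of length $k$ and $R\subseteq\{0,\dots,k\}^2$. An occurrence of $p$ in a permutation $\pi$ of length $n$ is a subset $\omega\subseteq G(\pi)$ for which there are order-preserving injections $\alpha,\beta:[k]\to[n]$ such that (i) $\omega=\{(\alpha(i),\beta(j)):(i,j)\in G(\tau)\}$, and (ii) with $\alpha(0)=\beta(0)=0$, $\alpha(k+1)=\beta(k+1)=n+1$ and $R_{ij}=[\alpha(i)+1,\alpha(i+1)-1]\times[\beta(j)+1,\beta(j+1)-1]$, one has $R_{ij}\cap G(\pi)=\emptyset$ for every $(i,j)\in R$. A permutation avoids $p$ if it has no occurrence of $p$. A classical pattern $\pi$ is identified with the mesh pattern $(\pi,\emptyset)$. $\mathrm{Av}(S)$ is the set of all permutations (of all lengths) avoiding every pattern in $S$. *)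

theory Defs
  imports "HOL-Combinatorics.Permutations"
begin

text \<open>
  A permutation of length \<open>n\<close> is encoded as a pair \<open>(n, f)\<close> with \<open>f permutes {1..n}\<close>; since
  \<open>f\<close> is then the identity outside \<open>{1..n}\<close>, each bijection of \<open>{1..n}\<close> has exactly one
  encoding. The length has to be recorded because \<open>f\<close> alone does not determine it.
\<close>

type_synonym perm = "nat \<times> (nat \<Rightarrow> nat)"

definition is_perm :: "perm \<Rightarrow> bool" where
  "is_perm \<pi> \<longleftrightarrow> snd \<pi> permutes {1..fst \<pi>}"

definition plot :: "perm \<Rightarrow> (nat \<times> nat) set" where
  "plot \<pi> = {(i, snd \<pi> i) | i. i \<in> {1..fst \<pi>}}"

definition one_line :: "nat list \<Rightarrow> perm" where
  "one_line xs = (length xs, \<lambda>i. if i \<in> {1..length xs} then xs ! (i - 1) else i)"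

type_synonym mesh_pattern = "perm \<times> (nat \<times> nat) set"

definition is_mesh_pattern :: "mesh_pattern \<Rightarrow> bool" where
  "is_mesh_pattern p \<longleftrightarrow>
     is_perm (fst p) \<and> snd p \<subseteq> {0..fst (fst p)} \<times> {0..fst (fst p)}"

definition classical :: "perm \<Rightarrow> mesh_pattern" where
  "classical \<tau> = (\<tau>, {})"

text \<open>
  The boundary conventions \<open>\<alpha>(0) = \<beta>(0) = 0\<close> and \<open>\<alpha>(k+1) = \<beta>(k+1) = n+1\<close> are imposed directly
  on \<open>\<alpha>\<close> and \<open>\<beta>\<close>. The truncated subtractions are harmless: \<open>\<alpha>\<close> and \<open>\<beta>\<close> are positive on \<open>{1..k+1}\<close>.
\<close>

definition occurrence :: "mesh_pattern \<Rightarrow> perm \<Rightarrow> (nat \<times> nat) set \<Rightarrow> bool" where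
  "occurrence p \<pi> \<omega> \<longleftrightarrow>
     (let \<tau> = fst p; R = snd p; k = fst \<tau>; n = fst \<pi> in
      \<omega> \<subseteq> plot \<pi> \<and>
      (\<exists>\<alpha> \<beta> :: nat \<Rightarrow> nat.
         \<alpha> ` {1..k} \<subseteq> {1..n} \<and> strict_mono_on {1..k} \<alpha> \<and>
         \<beta> ` {1..k} \<subseteq> {1..n} \<and> strict_mono_on {1..k} \<beta> \<and>
         \<alpha> 0 = 0 \<and> \<alpha> (k + 1) = n + 1 \<and> \<beta> 0 = 0 \<and> \<beta> (k + 1) = n + 1 \<and>
         \<omega> = {(\<alpha> i, \<beta> j) | i j. (i, j) \<in> plot \<tau>} \<and>
         (\<forall>(i, j) \<in> R.
            ({\<alpha> i + 1..\<alpha> (i + 1) - 1} \<times> {\<beta> j + 1..\<beta> (j + 1) - 1}) \<inter> plot \<pi> = {})))"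

definition avoids :: "perm \<Rightarrow> mesh_pattern \<Rightarrow> bool" where
  "avoids \<pi> p \<longleftrightarrow> (\<nexists>\<omega>. occurrence p \<pi> \<omega>)"

definition Av :: "mesh_pattern set \<Rightarrow> perm set" where
  "Av S = {\<pi>. is_perm \<pi> \<and> (\<forall>p\<in>S. avoids \<pi> p)}"

definition m1 :: mesh_pattern where
  "m1 = (one_line [1, 2], {(0, 0), (0, 2), (1, 1), (1, 2), (2, 1)})"

definition m2 :: mesh_pattern where
  "m2 = (one_line [1, 2], {(0, 0), (0, 1), (0, 2), (1, 1), (1, 2), (2, 1)})"

lemma is_perm_one_line:
  assumes "distinct xs" "set xs = {1..length xs}"
  shows "is_perm (one_line xs)"
proof -
  let ?f = "\<lambda>i. if i \<in> {1..length xs} then xs ! (i - 1) else i"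
  have "inj_on ?f {1..length xs}"
    using assms(1) by (auto simp: inj_on_def nth_eq_iff_index_eq)
  moreover have "?f ` {1..length xs} \<subseteq> {1..length xs}"
  proof
    fix y assume "y \<in> ?f ` {1..length xs}"
    then obtain i where "i \<in> {1..length xs}" "y = xs ! (i - 1)" by auto
    then have "y \<in> set xs" by auto
    then show "y \<in> {1..length xs}" using assms(2) by simp
  qed
  ultimately have "bij_betw ?f {1..length xs} {1..length xs}"
    unfolding bij_betw_def using endo_inj_surj[of "{1..length xs}" ?f] by blast
  then have "?f permutes {1..length xs}"
    by (rule bij_imp_permutes) auto
  then show ?thesis by (simp add: is_perm_def one_line_def)
qed

lemma is_mesh_pattern_321: "is_mesh_pattern (classical (one_line [3, 2, 1]))"
proof -
  have "is_perm (one_line [3, 2, 1])" by (rule is_perm_one_line) auto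
  then show ?thesis by (simp add: is_mesh_pattern_def classical_def)
qed

lemma is_perm_12: "is_perm (one_line [1, 2])"
  by (rule is_perm_one_line) auto

lemma is_mesh_pattern_m1: "is_mesh_pattern m1"
  using is_perm_12 by (simp add: is_mesh_pattern_def m1_def) (simp add: one_line_def)

lemma is_mesh_pattern_m2: "is_mesh_pattern m2"
  using is_perm_12 by (simp add: is_mesh_pattern_def m2_def) (simp add: one_line_def)

end

(* An occurrence of m2 is an occurrence of m1. Conversely, let (a, f a), (b, f b) be an occurrence
   of m1 in a permutation f that avoids 321. If a = 1, nothing lies to the left of a and this is an
   occurrence of m2. Otherwise v = f 1 lies strictly between f a and f b, and the points in columns
   1 and c with f c = v + 1 form an occurrence of m2: a column d strictly between them with
   f d > v + 1 gives c < a, so that d, c, a is an occurrence of 321. *)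

theory Submission
  imports Defs
begin

text \<open>Shading enters an occurrence only through one emptiness condition per box, so a smaller
  shading imposes fewer conditions on the same \<open>\<alpha>\<close> and
  \<open>\<beta>\<close>.\<close>

lemma occurrence_mono:
  assumes "occurrence (\<tau>, R) \<pi> \<omega>" "S \<subseteq> R"
  shows "occurrence (\<tau>, S) \<pi> \<omega>"
  using assms(1) unfolding occurrence_def Let_def fst_conv snd_conv
  by (elim conj_forward ex_forward; (assumption | use assms(2) in blast))

lemma plot_image: "plot \<pi> = (\<lambda>i. (i, snd \<pi> i)) ` {1..fst \<pi>}"
  by (simp only: plot_def image_def) blast

lemma plot_one_line_12: "plot (one_line [1, 2]) = {(1, 1), (2, 2)}"
proof -
  have "{1..2::nat} = {1, 2}" by auto
  then show ?thesis by (simp add: plot_image one_line_def numeral_2_eq_2)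
qed

lemma plot_one_line_321: "plot (one_line [3, 2, 1]) = {(1, 3), (2, 2), (3, 1)}"
proof -
  have "{1..3::nat} = {1, 2, 3}" by auto
  then show ?thesis by (simp add: plot_image one_line_def numeral_2_eq_2 numeral_3_eq_3)
qed

text \<open>Both points lie on the plot, so \<open>\<beta>\<close> is determined by the two columns
  and the occurrence reduces to \<open>a\<close> and \<open>b\<close>. The four-entry lists hold
  \<open>\<alpha>\<close> and \<open>\<beta>\<close> with their boundary values; the bound on
  \<open>R\<close> keeps the index \<open>i + 1\<close> within them.\<close>

lemma occurrence_12D:
  assumes occ: "occurrence (one_line [1, 2], R) (n, f) \<omega>"
    and R: "R \<subseteq> {0..2} \<times> {0..2}"
  shows "\<exists>a b. 1 \<le> a \<and> a < b \<and> b \<le> n \<and> f a < f b \<and>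
    (\<forall>(i, j) \<in> R. \<forall>d \<in> {1..n}.
       \<not> ([0, a, b, n + 1] ! i < d \<and> d < [0, a, b, n + 1] ! (i + 1) \<and>
          [0, f a, f b, n + 1] ! j < f d \<and> f d < [0, f a, f b, n + 1] ! (j + 1)))"
proof -
  have k: "fst (one_line [1, 2]) = 2" by (simp add: one_line_def)
  from occ obtain \<alpha> \<beta> :: "nat \<Rightarrow> nat" where
    \<omega>: "\<omega> \<subseteq> plot (n, f)" and
    mono: "strict_mono_on {1..2} \<alpha>" "strict_mono_on {1..2} \<beta>" and
    bd: "\<alpha> 0 = 0" "\<alpha> (2 + 1) = n + 1" "\<beta> 0 = 0" "\<beta> (2 + 1) = n + 1" and
    w: "\<omega> = {(\<alpha> i, \<beta> j) | i j. (i, j) \<in> plot (one_line [1, 2])}" and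
    empty: "\<forall>(i, j) \<in> R.
      ({\<alpha> i + 1..\<alpha> (i + 1) - 1} \<times> {\<beta> j + 1..\<beta> (j + 1) - 1}) \<inter> plot (n, f) = {}"
    unfolding occurrence_def Let_def fst_conv snd_conv k by blast
  have "(\<alpha> 1, \<beta> 1) \<in> plot (n, f)" "(\<alpha> 2, \<beta> 2) \<in> plot (n, f)"
    using \<omega> w unfolding plot_one_line_12 by auto
  then have f: "f (\<alpha> 1) = \<beta> 1" "f (\<alpha> 2) = \<beta> 2" and r: "1 \<le> \<alpha> 1" "\<alpha> 2 \<le> n"
    by (auto simp: plot_def)
  have lt: "\<alpha> 1 < \<alpha> 2" "\<beta> 1 < \<beta> 2"
    using mono by (auto simp: strict_mono_on_def)
  have list: "[0, \<alpha> 1, \<alpha> 2, n + 1] ! i = \<alpha> i" "[0, \<beta> 1, \<beta> 2, n + 1] ! i = \<beta> i" if "i \<le> 3" for i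
  proof -
    from that consider "i = 0" | "i = 1" | "i = 2" | "i = 3" by linarith
    then show "[0, \<alpha> 1, \<alpha> 2, n + 1] ! i = \<alpha> i" "[0, \<beta> 1, \<beta> 2, n + 1] ! i = \<beta> i"
      using bd by (cases, simp_all)+
  qed
  have "\<not> ([0, \<alpha> 1, \<alpha> 2, n + 1] ! i < d \<and> d < [0, \<alpha> 1, \<alpha> 2, n + 1] ! (i + 1) \<and>
          [0, \<beta> 1, \<beta> 2, n + 1] ! j < f d \<and> f d < [0, \<beta> 1, \<beta> 2, n + 1] ! (j + 1))"
    if ij: "(i, j) \<in> R" and d: "d \<in> {1..n}" for i j d
  proof
    have le: "i \<le> 3" "i + 1 \<le> 3" "j \<le> 3" "j + 1 \<le> 3" using R ij by auto
    assume "[0, \<alpha> 1, \<alpha> 2, n + 1] ! i < d \<and> d < [0, \<alpha> 1, \<alpha> 2, n + 1] ! (i + 1) \<and>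
          [0, \<beta> 1, \<beta> 2, n + 1] ! j < f d \<and> f d < [0, \<beta> 1, \<beta> 2, n + 1] ! (j + 1)"
    then have "\<alpha> i < d \<and> d < \<alpha> (i + 1) \<and> \<beta> j < f d \<and> f d < \<beta> (j + 1)"
      by (simp only: list[OF le(1)] list[OF le(2)] list[OF le(3)] list[OF le(4)])
    then have "(d, f d) \<in> {\<alpha> i + 1..\<alpha> (i + 1) - 1} \<times> {\<beta> j + 1..\<beta> (j + 1) - 1}" by auto
    moreover have "(d, f d) \<in> plot (n, f)" using d by (auto simp: plot_def)
    ultimately show False using empty ij by blast
  qed
  then show ?thesis
    using r lt by (intro exI[of _ "\<alpha> 1"] exI[of _ "\<alpha> 2"]) (simp only: f, blast)
qed

text \<open>Converse of \<open>occurrence_12D\<close>: taking the lists themselves as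
  \<open>\<alpha>\<close> and \<open>\<beta>\<close> makes the emptiness conditions agree literally
  with the hypothesis on \<open>R\<close>.\<close>

lemma occurrence_12I:
  assumes f: "f permutes {1..n}" and ab: "1 \<le> a" "a < b" "b \<le> n" "f a < f b"
    and R: "\<forall>(i, j) \<in> R. \<forall>d \<in> {1..n}.
       \<not> ([0, a, b, n + 1] ! i < d \<and> d < [0, a, b, n + 1] ! (i + 1) \<and>
          [0, f a, f b, n + 1] ! j < f d \<and> f d < [0, f a, f b, n + 1] ! (j + 1))"
  shows "\<exists>\<omega>. occurrence (one_line [1, 2], R) (n, f) \<omega>"
proof -
  have k: "fst (one_line [1, 2]) = 2" by (simp add: one_line_def)
  have s: "{1..2::nat} = {1, 2}" by auto
  have fr: "f i \<in> {1..n}" if "1 \<le> i" "i \<le> n" for i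
    using permutes_in_image[OF f, of i] that by auto
  define \<alpha> where "\<alpha> = (\<lambda>i. [0, a, b, n + 1] ! i)"
  define \<beta> where "\<beta> = (\<lambda>i. [0, f a, f b, n + 1] ! i)"
  have v: "\<alpha> 0 = 0" "\<alpha> 1 = a" "\<alpha> 2 = b" "\<alpha> (2 + 1) = n + 1"
    "\<beta> 0 = 0" "\<beta> 1 = f a" "\<beta> 2 = f b" "\<beta> (2 + 1) = n + 1"
    by (simp_all add: \<alpha>_def \<beta>_def)
  let ?\<omega> = "{(\<alpha> i, \<beta> j) | i j. (i, j) \<in> plot (one_line [1, 2])}"
  have "?\<omega> \<subseteq> plot (n, f)" unfolding plot_one_line_12 using ab v by (auto simp: plot_def)
  moreover have "\<alpha> ` {1..2} \<subseteq> {1..n}" "\<beta> ` {1..2} \<subseteq> {1..n}"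
    unfolding s using ab v fr[of a] fr[of b] by auto
  moreover have "strict_mono_on {1..2} \<alpha>" "strict_mono_on {1..2} \<beta>"
    unfolding s strict_mono_on_def using ab v by auto
  moreover have "\<forall>(i, j) \<in> R.
      ({\<alpha> i + 1..\<alpha> (i + 1) - 1} \<times> {\<beta> j + 1..\<beta> (j + 1) - 1}) \<inter> plot (n, f) = {}"
  proof -
    have False if ij: "(i, j) \<in> R" and p: "d \<in> {1..n}"
      and m: "d \<in> {\<alpha> i + 1..\<alpha> (i + 1) - 1}" "f d \<in> {\<beta> j + 1..\<beta> (j + 1) - 1}" for i j d
    proof -
      \<comment> \<open>The truncated subtraction is harmless: the lower bounds make
        \<open>d\<close> and \<open>f d\<close> positive, so the upper ends of the intervals are
        positive too.\<close>
      have "\<alpha> i < d" "d < \<alpha> (i + 1)" "\<beta> j < f d" "f d < \<beta> (j + 1)"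
        using m unfolding atLeastAtMost_iff by linarith+
      with R ij p show False unfolding \<alpha>_def \<beta>_def by blast
    qed
    then show ?thesis by (fastforce simp: plot_image simp del: atLeastAtMost_iff)
  qed
  ultimately have "occurrence (one_line [1, 2], R) (n, f) ?\<omega>"
    unfolding occurrence_def Let_def fst_conv snd_conv k using v by blast
  then show ?thesis by blast
qed

lemma occurrence_321I:
  assumes f: "f permutes {1..n}" and abc: "1 \<le> a" "a < b" "b < c" "c \<le> n"
    and desc: "f c < f b" "f b < f a"
  shows "\<exists>\<omega>. occurrence (classical (one_line [3, 2, 1])) (n, f) \<omega>"
proof -
  have k: "fst (one_line [3, 2, 1]) = 3" by (simp add: one_line_def)
  have s: "{1..3::nat} = {1, 2, 3}" by auto
  have fr: "f i \<in> {1..n}" if "1 \<le> i" "i \<le> n" for i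
    using permutes_in_image[OF f, of i] that by auto
  define \<alpha> where "\<alpha> = (\<lambda>i. [0, a, b, c, n + 1] ! i)"
  \<comment> \<open>The values are listed from right to left because \<open>\<beta>\<close> has to
    increase while \<open>f\<close> decreases along \<open>a\<close>, \<open>b\<close>,
    \<open>c\<close>.\<close>
  define \<beta> where "\<beta> = (\<lambda>i. [0, f c, f b, f a, n + 1] ! i)"
  have v: "\<alpha> 0 = 0" "\<alpha> 1 = a" "\<alpha> 2 = b" "\<alpha> 3 = c" "\<alpha> (3 + 1) = n + 1"
    "\<beta> 0 = 0" "\<beta> 1 = f c" "\<beta> 2 = f b" "\<beta> 3 = f a" "\<beta> (3 + 1) = n + 1"
    by (simp_all add: \<alpha>_def \<beta>_def)
  let ?\<omega> = "{(\<alpha> i, \<beta> j) | i j. (i, j) \<in> plot (one_line [3, 2, 1])}"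
  have "?\<omega> \<subseteq> plot (n, f)" unfolding plot_one_line_321 using abc v by (auto simp: plot_def)
  moreover have "\<alpha> ` {1..3} \<subseteq> {1..n}" "\<beta> ` {1..3} \<subseteq> {1..n}"
    unfolding s using abc v fr[of a] fr[of b] fr[of c] by auto
  moreover have "strict_mono_on {1..3} \<alpha>" "strict_mono_on {1..3} \<beta>"
    unfolding s strict_mono_on_def using abc desc v by auto
  ultimately have "occurrence (one_line [3, 2, 1], {}) (n, f) ?\<omega>"
    unfolding occurrence_def Let_def fst_conv snd_conv k using v by blast
  then show ?thesis unfolding classical_def by blast
qed

text \<open>No column precedes column 1, so the boxes (0,0), (0,1), (0,2) are empty automatically.
  Of the rest, \<open>right\<close> clears (1,1) and (1,2), and \<open>above\<close> clears
  (2,1).\<close>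

lemma occurrence_m2_if_first_ascent:
  assumes f: "f permutes {1..n}" and c: "1 < c" "c \<le> n" "f 1 < f c"
    and right: "\<And>d. 1 < d \<Longrightarrow> d < c \<Longrightarrow> f d < f 1"
    and above: "\<And>d. c < d \<Longrightarrow> d \<le> n \<Longrightarrow> f 1 < f d \<Longrightarrow> f c < f d"
  shows "\<exists>\<omega>. occurrence m2 (n, f) \<omega>"
proof -
  have "\<not> (1 < d \<and> d < c \<and> f 1 < f d)" for d
    using right[of d] by linarith
  moreover have "\<not> (1 < d \<and> d < c \<and> f c < f d)" for d
    using right[of d] c by linarith
  moreover have "\<not> (c < d \<and> d \<le> n \<and> f 1 < f d \<and> f d < f c)" for d
    using above[of d] by linarith
  ultimately show ?thesis
    unfolding m2_def by (intro occurrence_12I[OF f _ c]) (auto simp: numeral_2_eq_2)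
qed

lemma contains_m2_if_contains_m1:
  assumes f: "f permutes {1..n}"
    and av: "avoids (n, f) (classical (one_line [3, 2, 1]))"
    and occ: "occurrence m1 (n, f) \<omega>"
  shows "\<exists>\<omega>. occurrence m2 (n, f) \<omega>"
proof -
  have "\<exists>a b. 1 \<le> a \<and> a < b \<and> b \<le> n \<and> f a < f b \<and>
    (\<forall>(i, j) \<in> {(0, 0), (0, 2), (1, 1), (1, 2), (2, 1)}. \<forall>d \<in> {1..n}.
       \<not> ([0, a, b, n + 1] ! i < d \<and> d < [0, a, b, n + 1] ! (i + 1) \<and>
          [0, f a, f b, n + 1] ! j < f d \<and> f d < [0, f a, f b, n + 1] ! (j + 1)))"
    by (rule occurrence_12D[OF occ[unfolded m1_def]]) auto
  then obtain a b where ab: "1 \<le> a" "a < b" "b \<le> n" "f a < f b"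
    and R: "\<forall>(i, j) \<in> {(0, 0), (0, 2), (1, 1), (1, 2), (2, 1)}. \<forall>d \<in> {1..n}.
       \<not> ([0, a, b, n + 1] ! i < d \<and> d < [0, a, b, n + 1] ! (i + 1) \<and>
          [0, f a, f b, n + 1] ! j < f d \<and> f d < [0, f a, f b, n + 1] ! (j + 1))"
    by blast
  have fr: "1 \<le> f i \<and> f i \<le> n" if "1 \<le> i" "i \<le> n" for i
    using permutes_in_image[OF f, of i] that by auto
  have inj: "f i = f j \<longleftrightarrow> i = j" for i j
    using permutes_inj[OF f] by (auto dest: injD)
  \<comment> \<open>The conditions for the boxes (0,0), (0,2), (1,1), (1,2), (2,1), in this
    order.\<close>
  have mesh:
    "\<not> (0 < d \<and> d < a \<and> 0 < f d \<and> f d < f a)"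
    "\<not> (0 < d \<and> d < a \<and> f b < f d \<and> f d < n + 1)"
    "\<not> (a < d \<and> d < b \<and> f a < f d \<and> f d < f b)"
    "\<not> (a < d \<and> d < b \<and> f b < f d \<and> f d < n + 1)"
    "\<not> (b < d \<and> d < n + 1 \<and> f a < f d \<and> f d < f b)" if "1 \<le> d" "d \<le> n" for d
    using R that by (auto simp: numeral_2_eq_2)
  \<comment> \<open>With (0,0) and (0,2) empty, a point left of \<open>a\<close> can only lie in the
    box (0,1); injectivity excludes the heights \<open>f a\<close> and \<open>f b\<close>.\<close>
  have left: "f a < f d" "f d < f b" if "1 \<le> d" "d < a" for d
    using mesh(1,2)[of d] fr[of d] inj[of d a] inj[of d b] that ab by linarith+
  \<comment> \<open>The boxes (1,1) and (1,2) are empty, which leaves only (1,0).\<close>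
  have between: "f d < f a" if "a < d" "d < b" for d
    using mesh(3,4)[of d] fr[of d] inj[of d a] inj[of d b] that ab by linarith
  have right: "f b < f d" if "b < d" "d \<le> n" "f a < f d" for d
    using mesh(5)[of d] inj[of d b] that ab by linarith
  show ?thesis
  proof (cases "a = 1")
    case True
    show ?thesis
      by (rule occurrence_m2_if_first_ascent[OF f, of b]) (use True ab between right in auto)
  next
    case False
    with ab have a: "1 < a" by simp
    have f1: "f a < f 1" "f 1 < f b" using left[of 1] a by auto
    \<comment> \<open>Since \<open>f 1 < f b\<close>, the value \<open>f 1 + 1\<close> is at most
      \<open>f b\<close>, hence at most \<open>n\<close>, and is attained in some column.\<close>
    have "f 1 + 1 \<in> {1..n}" using f1 fr[of b] ab by auto
    then have "f 1 + 1 \<in> f ` {1..n}" using permutes_image[OF f] by simp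
    then obtain c where "c \<in> {1..n}" "f c = f 1 + 1" by force
    then have c: "1 \<le> c" "c \<le> n" "f c = f 1 + 1" by simp_all
    then have c1: "1 < c" by (cases "c = 1") auto
    have below: "f d < f 1" if d: "1 < d" "d < c" for d
    proof (rule ccontr)
      assume "\<not> f d < f 1"
      \<comment> \<open>No value lies strictly between \<open>f 1\<close> and
        \<open>f c = f 1 + 1\<close>, and \<open>d\<close> differs from both columns.\<close>
      then have fd: "f c < f d" using inj[of d 1] inj[of d c] c d by linarith
      then have "d \<noteq> a" using c f1 by auto
      show False
      proof (cases "c < a")
        case True
        have "\<exists>\<omega>. occurrence (classical (one_line [3, 2, 1])) (n, f) \<omega>"
          by (rule occurrence_321I[OF f, of d c a]) (use d True ab fd c f1 in auto)
        then show False using av by (simp add: avoids_def)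
      next
        case False
        \<comment> \<open>Here \<open>f a < f 1 < f c \<le> f b\<close>. The first part rules out
          \<open>c = a\<close> and, by \<open>between\<close>, any \<open>c\<close> strictly between
          \<open>a\<close> and \<open>b\<close>; a column right of \<open>b\<close> would give
          \<open>f b < f c\<close> by \<open>right\<close>.\<close>
        have "c = b"
        proof (rule ccontr)
          assume "c \<noteq> b"
          then consider "c = a" | "a < c" "c < b" | "b < c" using False by linarith
          then show False using between[of c] right[of c] c f1 by cases auto
        qed
        \<comment> \<open>Now \<open>d\<close> is a column before \<open>b\<close> with a point
          above \<open>f b\<close>, which \<open>left\<close> forbids before \<open>a\<close> and
          \<open>between\<close> forbids after \<open>a\<close>.\<close>
        then have "f b < f d" "d < b" using fd d by simp_all
        then show False using left[of d] between[of d] d ab \<open>d \<noteq> a\<close> by linarith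
      qed
    qed
    \<comment> \<open>This is where the choice of \<open>c\<close> clears the box (2,1): its points
      would need a height strictly between two consecutive integers.\<close>
    have "f c < f d" if "c < d" "f 1 < f d" for d
      using inj[of d c] c(3) that by linarith
    then show ?thesis
      by (intro occurrence_m2_if_first_ascent[OF f c1 c(2)] below) (simp_all add: c(3))
  qed
qed

theorem mainTheorem11:
  shows "Av {classical (one_line [3, 2, 1]), m1} = Av {classical (one_line [3, 2, 1]), m2}"
proof -
  have "occurrence m2 \<pi> \<omega> \<Longrightarrow> occurrence m1 \<pi> \<omega>" for \<pi> \<omega>
    unfolding m1_def m2_def by (erule occurrence_mono) auto
  moreover have "\<exists>\<omega>. occurrence m2 \<pi> \<omega>"
    if "is_perm \<pi>" "avoids \<pi> (classical (one_line [3, 2, 1]))" "occurrence m1 \<pi> \<omega>" for \<pi> \<omega>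
    using that contains_m2_if_contains_m1[of "snd \<pi>" "fst \<pi>" \<omega>] by (simp add: is_perm_def)
  ultimately show ?thesis
    unfolding Av_def avoids_def by blast
qed

end
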